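(* Let $k\ge 2$ be an integer and let $\psi_k$ be the $k$th central moment kernel. Then for all real numbers $\lambda,\mu$ and $x_1,\ldots,x_k$, $$\psi_k(\lambda x_1+\mu,\ldots,\lambda x_k+\mu)=\lambda^k\,\psi_k(x_1,\ldots,x_k).$$
   Context: For an integer $k\ge 2$, the $k$th central moment kernel is $$\psi_k(x_1,\ldots,x_k)=\sum_{j=0}^{k-2}(-1)^j\frac{1}{k-j}\sum x_{i_1}^{k-j}x_{i_2}\cdots x_{i_{j+1}}+(-1)^{k-1}(k-1)x_1\cdots x_k,$$ where the inner sum is over $i_1,\ldots,i_{j+1}\in\{1,\ldots,k\}$ pairwise distinct with $i_2<i_3<\cdots<i_{j+1}$. *)

theory Defs
  imports Complex_Main "HOL-Library.FuncSet"
begin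

(* The index tuples (i_1, ..., i_{j+1}) of the inner sum, as functions on {1..j+1}.
   Extensionality outside {1..j+1} makes each tuple correspond to exactly one function. *)
definition kernel_indices :: "nat \<Rightarrow> nat \<Rightarrow> (nat \<Rightarrow> nat) set" where
  "kernel_indices k j =
     {i \<in> {1..j+1} \<rightarrow>\<^sub>E {1..k}. inj_on i {1..j+1} \<and> strict_mono_on {2..j+1} i}"

(* The argument (x_1, ..., x_k) is given as x :: nat => real; only x 1, ..., x k are used.
   The definition is meant for k >= 2, where the subtractions on nat do not truncate. *)
definition central_moment_kernel :: "nat \<Rightarrow> (nat \<Rightarrow> real) \<Rightarrow> real" where
  "central_moment_kernel k x =
     (\<Sum>j=0..k-2. (-1) ^ j * (1 / real (k - j)) *
        (\<Sum>i\<in>kernel_indices k j. x (i 1) ^ (k - j) * (\<Prod>l=2..j+1. x (i l))))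
     + (-1) ^ (k - 1) * real (k - 1) * (\<Prod>l=1..k. x l)"

end

theory Submission
  imports Defs
begin

text \<open>
  The kernel has an integral representation from which the claim is immediate:
    \<open>\<psi>\<^sub>k(x) = \<Sum>\<^sub>m \<integral>\<^sub>0\<^bsup>x_m\<^esup> \<Prod>\<^bsub>l\<noteq>m\<^esub> (t - x\<^sub>l) dt + \<Prod>\<^sub>l (0 - x\<^sub>l)\<close>,
  where \<open>m\<close> and \<open>l\<close> range over \<open>1, \<dots>, k\<close>.
  Indeed, expanding the integrand in elementary symmetric functions of the \<open>x\<^sub>l\<close> with \<open>l \<noteq> m\<close> and
  integrating termwise gives the terms of the defining sum for \<open>j \<le> k - 2\<close>; the terms with
  \<open>j = k - 1\<close> add up to \<open>(-1)\<^bsup>k-1\<^esup> k x\<^sub>1 \<dots> x\<^sub>k\<close>, and the last product corrects the factor \<open>k\<close> to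
  \<open>k - 1\<close> (\<open>central_moment_kernel_eq_root_primitive\<close>).

  The base point \<open>0\<close> may be replaced by any real \<open>c\<close>, because the derivative of the right-hand side
  in \<open>c\<close> is \<open>- \<Sum>\<^sub>m \<Prod>\<^bsub>l\<noteq>m\<^esub> (c - x\<^sub>l) + d/dc \<Prod>\<^sub>l (c - x\<^sub>l) = 0\<close>
  (\<open>central_moment_kernel_base_point\<close>).  For the point \<open>a x + b\<close> one chooses the base point \<open>b\<close> and
  substitutes \<open>t = a s + b\<close>: each of the \<open>k - 1\<close> factors and \<open>dt\<close> contribute one factor \<open>a\<close>
  (\<open>root_primitive_affine\<close>), and so does each of the \<open>k\<close> factors of the last product.  No division
  by \<open>a\<close> occurs, so the case \<open>a = 0\<close> is included.
\<close>

section \<open>Elementary symmetric functions\<close>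

text \<open>The elementary symmetric function of degree \<open>j\<close> in the values of \<open>x\<close> on a finite set \<open>A\<close>.\<close>

definition elem_sym :: "nat \<Rightarrow> 'i set \<Rightarrow> ('i \<Rightarrow> real) \<Rightarrow> real" where
  "elem_sym j A x = (\<Sum>S | S \<subseteq> A \<and> card S = j. \<Prod>l\<in>S. x l)"

lemma prod_diff_eq_sum_elem_sym:
  assumes "finite A"
  shows "(\<Prod>l\<in>A. t - x l) = (\<Sum>j=0..card A. (-1) ^ j * elem_sym j A x * t ^ (card A - j))"
proof -
  have "(\<Prod>l\<in>A. t - x l) = (\<Prod>l\<in>A. - x l + t)"
    by (intro prod.cong) auto
  also have "\<dots> = (\<Sum>S\<in>Pow A. (\<Prod>l\<in>S. - x l) * (\<Prod>l\<in>A-S. t))"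
    by (rule prod_add[OF assms])
  also have "\<dots> = (\<Sum>S\<in>Pow A. (-1) ^ card S * (\<Prod>l\<in>S. x l) * t ^ (card A - card S))"
    using assms by (intro sum.cong refl) (auto simp: prod_uminus card_Diff_subset finite_subset)
  also have "\<dots> = (\<Sum>j=0..card A. \<Sum>S | S \<in> Pow A \<and> card S = j.
                     (-1) ^ card S * (\<Prod>l\<in>S. x l) * t ^ (card A - card S))"
    using assms by (intro sum.group[symmetric]) (auto intro: card_mono)
  also have "\<dots> = (\<Sum>j=0..card A. (-1) ^ j * elem_sym j A x * t ^ (card A - j))"
    unfolding elem_sym_def sum_distrib_left sum_distrib_right by (intro sum.cong) auto
  finally show ?thesis .
qed

lemma elem_sym_card:
  assumes "finite A"
  shows "elem_sym (card A) A x = (\<Prod>l\<in>A. x l)"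
proof -
  have "{S. S \<subseteq> A \<and> card S = card A} = {A}"
    using assms by (auto dest: card_subset_eq)
  then show ?thesis by (simp add: elem_sym_def)
qed

section \<open>The index tuples of the kernel\<close>

text \<open>
  An index tuple \<open>(i\<^sub>1, \<dots>, i\<^bsub>j+1\<^esub>)\<close> with \<open>i\<^sub>2 < \<dots> < i\<^bsub>j+1\<^esub>\<close> amounts to the choice of \<open>m = i\<^sub>1\<close> and of
  the \<open>j\<close>-element set \<open>S = {i\<^sub>2, \<dots>, i\<^bsub>j+1\<^esub>}\<close> avoiding \<open>m\<close>.
\<close>

lemma bij_betw_kernel_indices:
  "bij_betw (\<lambda>i. (i 1, i ` {2..j+1})) (kernel_indices k j)
     (SIGMA m:{1..k}. {S. S \<subseteq> {1..k} - {m} \<and> card S = j})"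
  unfolding bij_betw_def
proof
  show "inj_on (\<lambda>i. (i 1, i ` {2..j+1})) (kernel_indices k j)"
  proof (rule inj_onI)
    (* The increasing list of the values on {2..j+1} is determined by their set. *)
    fix i i' assume i: "i \<in> kernel_indices k j" and i': "i' \<in> kernel_indices k j"
      and eq: "(i 1, i ` {2..j+1}) = (i' 1, i' ` {2..j+1})"
    have sorted: "sorted_wrt (<) (map h [2..<j+2])" if "h \<in> kernel_indices k j" for h
      using that unfolding kernel_indices_def
      by (intro sorted_wrt_map_mono[OF sorted_wrt_upt]) (auto intro: strict_mono_onD)
    have "set (map h [2..<j+2]) = h ` {2..j+1}" for h :: "nat \<Rightarrow> nat"
      unfolding set_map set_upt by (intro image_cong) auto
    then have "map i [2..<j+2] = map i' [2..<j+2]"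
      using eq by (intro strict_sorted_equal sorted i i') auto
    then have "i l = i' l" if "l \<in> {2..j+1}" for l
    proof -
      have "l \<in> set [2..<j+2]" using that by (simp only: set_upt) auto
      with \<open>map i [2..<j+2] = map i' [2..<j+2]\<close> show ?thesis
        unfolding map_eq_conv by blast
    qed
    moreover have "{1..j+1} = insert 1 {2..j+1}" by auto
    ultimately have "i l = i' l" if "l \<in> {1..j+1}" for l
      using that eq by auto
    with i i' show "i = i'"
      unfolding kernel_indices_def by (auto intro: PiE_ext)
  qed
next
  let ?I = "(\<lambda>i. (i 1, i ` {2..j+1})) ` kernel_indices k j"
  let ?T = "SIGMA m:{1..k}. {S. S \<subseteq> {1..k} - {m} \<and> card S = j}"
  show "?I = ?T"
  proof
    show "?I \<subseteq> ?T"
    proof (rule image_subsetI)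
      fix i assume i: "i \<in> kernel_indices k j"
      then have inj: "inj_on i {1..j+1}" and ran: "i ` {1..j+1} \<subseteq> {1..k}"
        by (auto simp: kernel_indices_def)
      have ivl: "{1..j+1} = insert 1 {2..j+1}" by auto
      have "i 1 \<in> {1..k}"
        using ran unfolding ivl by blast
      moreover have "i 1 \<notin> i ` {2..j+1}"
        using inj unfolding ivl inj_on_insert by simp
      then have "i ` {2..j+1} \<subseteq> {1..k} - {i 1}"
        using ran unfolding ivl by blast
      moreover have "card (i ` {2..j+1}) = j"
        using inj unfolding ivl inj_on_insert by (simp add: card_image)
      ultimately show "(i 1, i ` {2..j+1}) \<in> ?T"
        by blast
    qed
  next
    show "?T \<subseteq> ?I"
    proof clarify
      fix m S assume m: "m \<in> {1..k}" and S: "S \<subseteq> {1..k} - {m}" and j: "j = card S"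
      let ?xs = "sorted_list_of_set S"
      have fin: "finite S"
        using S finite_subset by blast
      define i where "i = (\<lambda>l\<in>{1..j+1}. if l = 1 then m else ?xs ! (l - 2))"
      have i1: "i 1 = m" by (simp add: i_def)
      have i2: "i l = ?xs ! (l - 2)" if "l \<in> {2..j+1}" for l
        using that by (auto simp: i_def)
      have len: "length ?xs = j"
        by (simp add: j)
      have mono: "strict_mono_on {2..j+1} i"
      proof (rule monotone_onI)
        fix p q assume "p \<in> {2..j+1}" "q \<in> {2..j+1}" "p < q"
        then show "i p < i q"
          using len by (auto simp: i2 intro!: sorted_wrt_nth_less[OF strict_sorted_list_of_set])
      qed
      have img: "i ` {2..j+1} = S"
      proof -
        have "{2..j+1} = (\<lambda>n. n + 2) ` {..<j}"
        proof (intro equalityI subsetI)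
          fix l assume "l \<in> {2..j+1}"
          then show "l \<in> (\<lambda>n. n + 2) ` {..<j}"
            by (intro image_eqI[where x = "l - 2"]) auto
        qed auto
        then have "i ` {2..j+1} = (\<lambda>n. i (n + 2)) ` {..<j}"
          by (simp only: image_image)
        also have "\<dots> = (!) ?xs ` {..<j}"
          by (intro image_cong) (auto simp: i2)
        also have "\<dots> = set ?xs"
          using len by (auto simp: set_conv_nth image_def)
        finally show ?thesis using fin by simp
      qed
      have ivl: "{1..j+1} = insert 1 {2..j+1}" by auto
      have "inj_on i {1..j+1}"
        unfolding ivl inj_on_insert
        using mono S i1 img by (auto simp: strict_mono_on_imp_inj_on)
      moreover have "i \<in> {1..j+1} \<rightarrow>\<^sub>E {1..k}"
      proof (rule PiE_I)
        fix l assume "l \<in> {1..j+1}"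
        then show "i l \<in> {1..k}"
          using m S i1 img unfolding ivl by blast
      qed (auto simp: i_def)
      ultimately have "i \<in> kernel_indices k j"
        using mono by (simp add: kernel_indices_def)
      then show "(m, S) \<in> (\<lambda>i. (i 1, i ` {2..card S+1})) ` kernel_indices k (card S)"
        using i1 img j by (intro image_eqI[where x = i]) auto
    qed
  qed
qed

lemma sum_kernel_indices:
  "(\<Sum>i\<in>kernel_indices k j. f (i 1) * (\<Prod>l=2..j+1. x (i l)))
     = (\<Sum>m=1..k. f m * elem_sym j ({1..k} - {m}) x)"
proof -
  have "(\<Sum>i\<in>kernel_indices k j. f (i 1) * (\<Prod>l=2..j+1. x (i l)))
      = (\<Sum>i\<in>kernel_indices k j. (\<lambda>(m, S). f m * (\<Prod>l\<in>S. x l)) (i 1, i ` {2..j+1}))"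
  proof (intro sum.cong refl)
    fix i assume "i \<in> kernel_indices k j"
    then have "inj_on i {1..j+1}"
      by (simp add: kernel_indices_def)
    then have "inj_on i {2..j+1}"
      by (rule inj_on_subset) simp
    then show "f (i 1) * (\<Prod>l=2..j+1. x (i l))
        = (\<lambda>(m, S). f m * (\<Prod>l\<in>S. x l)) (i 1, i ` {2..j+1})"
      by (simp add: prod.reindex)
  qed
  also have "\<dots> = (\<Sum>(m, S)\<in>(SIGMA m:{1..k}. {S. S \<subseteq> {1..k} - {m} \<and> card S = j}).
                     f m * (\<Prod>l\<in>S. x l))"
    by (rule sum.reindex_bij_betw[OF bij_betw_kernel_indices])
  also have "\<dots> = (\<Sum>m=1..k. \<Sum>S | S \<subseteq> {1..k} - {m} \<and> card S = j. f m * (\<Prod>l\<in>S. x l))"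
    by (rule sum.Sigma[symmetric]) auto
  also have "\<dots> = (\<Sum>m=1..k. f m * elem_sym j ({1..k} - {m}) x)"
    by (simp add: elem_sym_def sum_distrib_left)
  finally show ?thesis .
qed

section \<open>The primitive of a product of linear factors\<close>

text \<open>The primitive of \<open>\<Prod>\<^bsub>l\<in>A\<^esub> (t - x\<^sub>l)\<close> vanishing at \<open>0\<close>, written out as a polynomial in \<open>t\<close>.\<close>

definition root_primitive :: "'i set \<Rightarrow> ('i \<Rightarrow> real) \<Rightarrow> real \<Rightarrow> real" where
  "root_primitive A x t =
     (\<Sum>j=0..card A. (-1) ^ j * (1 / real (Suc (card A) - j)) * elem_sym j A x
                        * t ^ (Suc (card A) - j))"

lemma root_primitive_0 [simp]: "root_primitive A x 0 = 0"
  unfolding root_primitive_def by (intro sum.neutral) auto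

lemma has_field_derivative_root_primitive:
  assumes "finite A"
  shows "(root_primitive A x has_field_derivative (\<Prod>l\<in>A. t - x l)) (at t)"
proof -
  let ?c = "\<lambda>j. (-1) ^ j * (1 / real (Suc (card A) - j)) * elem_sym j A x"
  have "((\<lambda>t. \<Sum>j=0..card A. ?c j * t ^ (Suc (card A) - j)) has_field_derivative
          (\<Sum>j=0..card A. (-1) ^ j * elem_sym j A x * t ^ (card A - j))) (at t)"
  proof (rule DERIV_sum)
    fix j assume "j \<in> {0..card A}"
    then have *: "Suc (card A) - j = Suc (card A - j)" by auto
    show "((\<lambda>t. ?c j * t ^ (Suc (card A) - j)) has_field_derivative
            (-1) ^ j * elem_sym j A x * t ^ (card A - j)) (at t)"
      unfolding * using DERIV_cmult[OF DERIV_pow[of "Suc (card A - j)" t],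
        of "(-1) ^ j * (1 / real (Suc (card A - j))) * elem_sym j A x"]
      by (simp add: mult_ac del: of_nat_Suc power_Suc)
  qed
  then show ?thesis
    by (simp add: root_primitive_def[abs_def] prod_diff_eq_sum_elem_sym[OF assms])
qed

text \<open>
  The substitution \<open>t = a s + b\<close> in the integral from \<open>b\<close> to \<open>a s + b\<close>.  Comparing derivatives in
  \<open>s\<close> proves it for every \<open>a\<close>, including \<open>0\<close>.
\<close>

lemma root_primitive_affine:
  fixes a b s :: real
  assumes "finite A"
  shows "root_primitive A (\<lambda>l. a * x l + b) (a * s + b) - root_primitive A (\<lambda>l. a * x l + b) b
           = a ^ Suc (card A) * root_primitive A x s"
proof -
  let ?y = "\<lambda>l. a * x l + b"
  let ?d = "\<lambda>s. root_primitive A ?y (a * s + b) - a ^ Suc (card A) * root_primitive A x s"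
  (* Both terms of ?d have the same derivative in s, so ?d is constant; its value at 0 gives
     the subtracted term. *)
  have "DERIV ?d s :> 0" for s
  proof -
    have "DERIV (\<lambda>s. a * s + b) s :> a"
      by (auto intro!: derivative_eq_intros)
    then have "DERIV (\<lambda>s. root_primitive A ?y (a * s + b)) s :> (\<Prod>l\<in>A. (a * s + b) - ?y l) * a"
      by (rule DERIV_chain2[OF has_field_derivative_root_primitive[OF assms]])
    moreover have "(\<Prod>l\<in>A. (a * s + b) - ?y l) = (\<Prod>l\<in>A. a * (s - x l))"
      by (intro prod.cong) (auto simp: algebra_simps)
    then have "(\<Prod>l\<in>A. (a * s + b) - ?y l) * a = a ^ Suc (card A) * (\<Prod>l\<in>A. s - x l)"
      by (simp add: prod.distrib)
    ultimately have "DERIV ?d s :> a ^ Suc (card A) * (\<Prod>l\<in>A. s - x l)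
                                    - a ^ Suc (card A) * (\<Prod>l\<in>A. s - x l)"
      by (intro DERIV_diff DERIV_cmult has_field_derivative_root_primitive[OF assms]) metis
    then show ?thesis by simp
  qed
  then have "?d s = ?d 0"
    by (intro DERIV_isconst_all) blast
  then show ?thesis by simp
qed

section \<open>The integral representation of the kernel\<close>

lemma central_moment_kernel_eq_root_primitive:
  assumes "k \<ge> 2"
  shows "central_moment_kernel k x
           = (\<Sum>m=1..k. root_primitive ({1..k} - {m}) x (x m)) + (\<Prod>l=1..k. 0 - x l)"
proof -
  let ?e = "\<lambda>j m. elem_sym j ({1..k} - {m}) x"
  let ?t = "\<lambda>j. \<Sum>m=1..k. (-1) ^ j * (1 / real (k - j)) * ?e j m * x m ^ (k - j)"
  have "(\<Sum>m=1..k. root_primitive ({1..k} - {m}) x (x m))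
      = (\<Sum>m=1..k. \<Sum>j=0..k-1. (-1) ^ j * (1 / real (k - j)) * ?e j m * x m ^ (k - j))"
  proof (intro sum.cong refl)
    fix m assume "m \<in> {1..k}"
    then have "card ({1..k} - {m}) = k - 1" "Suc (k - 1) = k" by auto
    then show "root_primitive ({1..k} - {m}) x (x m)
        = (\<Sum>j=0..k-1. (-1) ^ j * (1 / real (k - j)) * ?e j m * x m ^ (k - j))"
      by (simp only: root_primitive_def)
  qed
  also have "\<dots> = (\<Sum>j=0..k-1. ?t j)"
    by (rule sum.swap)
  (* The kernel has no term of index k - 1 of this shape: combined with the product of the 0 - x l,
     it gives the last summand of the kernel. *)
  also have "\<dots> = (\<Sum>j=0..k-2. ?t j) + ?t (k - 1)"
  proof -
    have "k - 1 = Suc (k - 2)" using assms by simp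
    then show ?thesis by (simp only: sum.atLeast0_atMost_Suc)
  qed
  also have "?t (k - 1) = (-1) ^ (k - 1) * real k * (\<Prod>l=1..k. x l)"
  proof -
    have "(-1) ^ (k-1) * (1 / real (k - (k-1))) * ?e (k-1) m * x m ^ (k - (k-1))
        = (-1) ^ (k-1) * (\<Prod>l=1..k. x l)" if m: "m \<in> {1..k}" for m
    proof -
      have "?e (k-1) m = (\<Prod>l\<in>{1..k}-{m}. x l)"
        using m elem_sym_card[of "{1..k} - {m}" x] by simp
      moreover have "k - (k-1) = 1" using assms by simp
      ultimately show ?thesis
        using prod.remove[OF _ m, of x] by simp
    qed
    then have "?t (k - 1) = (\<Sum>m=1..k. (-1) ^ (k-1) * (\<Prod>l=1..k. x l))"
      by (intro sum.cong) auto
    then show ?thesis by simp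
  qed
  also have "(\<Sum>j=0..k-2. ?t j) = (\<Sum>j=0..k-2. (-1) ^ j * (1 / real (k - j)) *
      (\<Sum>i\<in>kernel_indices k j. x (i 1) ^ (k - j) * (\<Prod>l=2..j+1. x (i l))))"
    by (intro sum.cong refl, subst sum_kernel_indices) (simp add: sum_distrib_left mult_ac)
  finally have sum: "(\<Sum>m=1..k. root_primitive ({1..k} - {m}) x (x m))
      = (\<Sum>j=0..k-2. (-1) ^ j * (1 / real (k - j)) *
          (\<Sum>i\<in>kernel_indices k j. x (i 1) ^ (k - j) * (\<Prod>l=2..j+1. x (i l))))
        + (-1) ^ (k - 1) * real k * (\<Prod>l=1..k. x l)" .
  have last: "(\<Prod>l=1..k. 0 - x l) = - ((-1) ^ (k - 1) * (\<Prod>l=1..k. x l))"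
  proof -
    have "(-1 :: real) ^ k = - ((-1) ^ (k - 1))"
      using assms by (cases k) auto
    then show ?thesis by (simp add: prod_uminus)
  qed
  have "real (k - 1) = real k - 1"
    using assms by (simp add: of_nat_diff)
  then show ?thesis
    unfolding central_moment_kernel_def sum last by (simp only:) (simp add: algebra_simps)
qed

lemma central_moment_kernel_base_point:
  assumes "k \<ge> 2"
  shows "central_moment_kernel k x
           = (\<Sum>m=1..k. root_primitive ({1..k} - {m}) x (x m) - root_primitive ({1..k} - {m}) x c)
               + (\<Prod>l=1..k. c - x l)"
proof -
  let ?F = "\<lambda>c. (\<Sum>m=1..k. root_primitive ({1..k} - {m}) x (x m)
                            - root_primitive ({1..k} - {m}) x c) + (\<Prod>l=1..k. c - x l)"
  have "DERIV ?F c :> 0" for c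
  proof -
    have "DERIV ?F c :> (\<Sum>m=1..k. 0 - (\<Prod>l\<in>{1..k} - {m}. c - x l))
                          + (\<Sum>m=1..k. 1 * (\<Prod>l\<in>{1..k} - {m}. c - x l))"
      by (intro DERIV_add DERIV_sum DERIV_diff DERIV_const has_field_derivative_prod
            has_field_derivative_root_primitive) (auto intro!: derivative_eq_intros)
    then show ?thesis by (simp add: sum_negf)
  qed
  then have "?F 0 = ?F c"
    by (intro DERIV_isconst_all) blast
  then show ?thesis
    by (simp add: central_moment_kernel_eq_root_primitive[OF assms])
qed

theorem mainTheorem3:
  fixes k :: nat and a b :: real and x :: "nat \<Rightarrow> real"
  assumes "k \<ge> 2"
  shows "central_moment_kernel k (\<lambda>l. a * x l + b) = a ^ k * central_moment_kernel k x"
proof -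
  let ?y = "\<lambda>l. a * x l + b"
  have "central_moment_kernel k ?y
      = (\<Sum>m=1..k. root_primitive ({1..k} - {m}) ?y (?y m) - root_primitive ({1..k} - {m}) ?y b)
          + (\<Prod>l=1..k. b - ?y l)"
    by (rule central_moment_kernel_base_point[OF assms])
  also have "\<dots> = (\<Sum>m=1..k. a ^ k * root_primitive ({1..k} - {m}) x (x m))
                    + (\<Prod>l=1..k. a * (0 - x l))"
  proof (intro arg_cong2[where f = "(+)"] sum.cong prod.cong refl)
    fix m assume "m \<in> {1..k}"
    then have "Suc (card ({1..k} - {m})) = k" by auto
    then show "root_primitive ({1..k} - {m}) ?y (?y m) - root_primitive ({1..k} - {m}) ?y b
                 = a ^ k * root_primitive ({1..k} - {m}) x (x m)"
      by (simp only: root_primitive_affine finite_Diff finite_atLeastAtMost)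
  qed simp
  also have "\<dots> = a ^ k * central_moment_kernel k x"
    using assms
    by (simp add: central_moment_kernel_eq_root_primitive prod.distrib sum_distrib_left
          distrib_left del: diff_0)
  finally show ?thesis .
qed

end
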